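(* Let $\{\gamma_i\}_{i=1}^\infty$ be a sequence of points in $\mathbb{H}(\mathbb{Z})$ such that for each $i$ we have $\|\gamma_i\|\geq 3$. Then the limit $\mathbb K \{\gamma_i\}$ exists. Furthermore, $CF( \mathbb K \{\gamma_i\}) = \{\gamma_i\}$.
   Context: The Heisenberg group $\mathbb H$ is $\mathbb C\times\mathbb R$ with group law $(z,t)*(z',t')=(z+z',t+t'+2\operatorname{Im}(\overline z z'))$, identity $0$ and inverse $(z,t)^{-1}=(-z,-t)$. The gauge norm is $\|(z,t)\|=\sqrt[4]{|z|^4+t^2}$ and the gauge metric is $d(h,k)=\|h^{-1}*k\|$. $\mathbb H(\mathbb Z)=\mathbb Z[i]\times\mathbb Z$ is the set of points with integer coordinates. The Koranyi inversion is $\iota(z,t)=\left(\frac{-z}{|z|^2+it},\frac{-t}{|z|^4+t^2}\right)$ on $\mathbb H\setminus\{0\}$. For a sequence $\{\gamma_i\}_{i=1}^n$ in $\mathbb H(\mathbb Z)$, $\mathbb K\{\gamma_i\}_{i=1}^n=\iota \gamma_1 \iota \gamma_2 \cdots \iota \gamma_n$ (composition of inversions and left multiplications, applied to the identity), and for an infinite sequence $\mathbb K\{\gamma_i\}=\lim_{n\to\infty}\mathbb K\{\gamma_i\}_{i=1}^n$ when the limit exists. $CF(h)$ denotes the continued fraction digits of $h$ with respect to a fundamental domain $K$ for $\mathbb H(\mathbb Z)$ (here the Dirichlet domain $K_D=\{h: d(0,h)\le d(g,h)\ \forall g\in\mathbb H(\mathbb Z)\}$, used in the proof): with $[h]=g$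 iff $h\in g*K$, one sets $\gamma_0=[h]$, $h_0=\gamma_0^{-1}*h$, $\gamma_{i+1}=[\iota h_i]$, $h_{i+1}=\gamma_{i+1}^{-1}*\iota h_i$. *)

theory Defs
  imports "HOL-Analysis.Analysis"
begin

text \<open>The Heisenberg group. Its law is written additively because \<open>group_add\<close> is the library's
  class of not necessarily commutative groups: \<open>g + h\<close> is the product $g * h$, \<open>- g\<close> is $g^{-1}$
  and \<open>0\<close> is the identity. A fresh type is used, since the product type \<open>complex \<times> real\<close> already
  carries the abelian group structure and the Euclidean metric.\<close>

datatype heis = Heis (hz: complex) (ht: real)

instantiation heis :: group_add
begin

definition zero_heis :: heis where
  "0 = Heis 0 0"

definition plus_heis :: "heis \<Rightarrow> heis \<Rightarrow> heis" where
  "g + h = Heis (hz g + hz h) (ht g + ht h + 2 * Im (cnj (hz g) * hz h))"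

definition uminus_heis :: "heis \<Rightarrow> heis" where
  "- g = Heis (- hz g) (- ht g)"

definition minus_heis :: "heis \<Rightarrow> heis \<Rightarrow> heis" where
  "g - h = g + (- h :: heis)"

instance
  by standard
    (auto simp: zero_heis_def plus_heis_def uminus_heis_def minus_heis_def algebra_simps)

end

definition gauge_norm :: "heis \<Rightarrow> real" where
  "gauge_norm h = root 4 (cmod (hz h) ^ 4 + ht h ^ 2)"

lemma gauge_norm_nonneg: "0 \<le> gauge_norm h"
  by (simp add: gauge_norm_def)

lemma gauge_norm_square: "gauge_norm h ^ 2 = cmod (Complex (cmod (hz h) ^ 2) (ht h))"
proof -
  have "(gauge_norm h ^ 2) ^ 2 = cmod (hz h) ^ 4 + ht h ^ 2"
    by (simp add: gauge_norm_def flip: power_mult)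
  moreover have "cmod (Complex (cmod (hz h) ^ 2) (ht h)) ^ 2 = cmod (hz h) ^ 4 + ht h ^ 2"
    using cmod_power2[of "Complex (cmod (hz h) ^ 2) (ht h)"] by (simp flip: power_mult)
  ultimately show ?thesis
    by (metis norm_ge_zero power2_eq_imp_eq zero_le_power2)
qed

lemma gauge_norm_eq_0: "gauge_norm h = 0 \<longleftrightarrow> h = 0"
proof -
  have "gauge_norm h = 0 \<longleftrightarrow> gauge_norm h ^ 2 = 0"
    by simp
  then show ?thesis
    unfolding gauge_norm_square by (cases h) (auto simp: zero_heis_def complex_eq_iff)
qed

lemma gauge_norm_uminus: "gauge_norm (- h) = gauge_norm h"
  by (simp add: gauge_norm_def uminus_heis_def)

lemma gauge_norm_hz: "cmod (hz h) \<le> gauge_norm h"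
proof -
  have "cmod (hz h) ^ 2 \<le> gauge_norm h ^ 2"
    unfolding gauge_norm_square using complex_Re_le_cmod[of "Complex (cmod (hz h) ^ 2) (ht h)"]
    by simp
  then show ?thesis
    using gauge_norm_nonneg power2_le_imp_le by blast
qed

lemma gauge_norm_ht: "\<bar>ht h\<bar> \<le> gauge_norm h ^ 2"
  unfolding gauge_norm_square using abs_Im_le_cmod[of "Complex (cmod (hz h) ^ 2) (ht h)"]
  by simp

lemma gauge_norm_triangle: "gauge_norm (g + h) \<le> gauge_norm g + gauge_norm h"
proof -
  let ?w = "\<lambda>h. Complex (cmod (hz h) ^ 2) (ht h)"
  have "?w (g + h) = ?w g + ?w h + 2 * (cnj (hz g) * hz h)"
    by (simp add: plus_heis_def complex_eq_iff cmod_power2) (simp add: power2_eq_square algebra_simps)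
  then have "cmod (?w (g + h)) \<le> cmod (?w g) + cmod (?w h) + cmod (2 * (cnj (hz g) * hz h))"
    by (metis (no_types, lifting) add_right_mono norm_triangle_ineq order_trans)
  then have "gauge_norm (g + h) ^ 2
      \<le> gauge_norm g ^ 2 + gauge_norm h ^ 2 + 2 * (cmod (hz g) * cmod (hz h))"
    by (simp add: gauge_norm_square norm_mult)
  also have "\<dots> \<le> gauge_norm g ^ 2 + gauge_norm h ^ 2 + 2 * (gauge_norm g * gauge_norm h)"
    by (intro add_mono mult_mono gauge_norm_hz gauge_norm_nonneg) auto
  also have "\<dots> = (gauge_norm g + gauge_norm h) ^ 2"
    by (simp add: power2_eq_square algebra_simps)
  finally show ?thesis
    using gauge_norm_nonneg power2_le_imp_le by (metis add_nonneg_nonneg)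
qed

text \<open>The topology of \<open>heis\<close>, hence \<open>convergent\<close> and \<open>lim\<close>, is that of the gauge metric.\<close>

instantiation heis :: metric_space
begin

definition dist_heis :: "heis \<Rightarrow> heis \<Rightarrow> real" where
  "dist h k = gauge_norm (- h + k)"

definition uniformity_heis :: "(heis \<times> heis) filter" where
  "uniformity_heis = (INF e\<in>{0<..}. principal {(x, y). dist x y < e})"

definition open_heis :: "heis set \<Rightarrow> bool" where
  "open_heis U \<longleftrightarrow> (\<forall>x\<in>U. \<forall>\<^sub>F (x', y) in uniformity. x' = x \<longrightarrow> y \<in> U)"

instance
proof
  fix x y z :: heis
  show "dist x y = 0 \<longleftrightarrow> x = y"
    by (simp add: dist_heis_def gauge_norm_eq_0) (metis neg_equal_iff_equal add_eq_0_iff2)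
  have "- x + y = (- x + z) + - (- y + z)"
    by (simp add: minus_add add.assoc)
  then show "dist x y \<le> dist x z + dist y z"
    unfolding dist_heis_def by (metis gauge_norm_triangle gauge_norm_uminus)
qed (simp_all add: uniformity_heis_def open_heis_def)

end

definition heis_int :: "heis set" where
  "heis_int = {h. Re (hz h) \<in> \<int> \<and> Im (hz h) \<in> \<int> \<and> ht h \<in> \<int>}"

text \<open>The Koranyi inversion. It is meant only on nonzero points; division by zero makes
  \<open>koranyi 0 = 0\<close>.\<close>

definition koranyi :: "heis \<Rightarrow> heis" where
  "koranyi h = Heis (- hz h / (of_real (cmod (hz h) ^ 2) + \<i> * of_real (ht h)))
                    (- ht h / (cmod (hz h) ^ 4 + ht h ^ 2))"

text \<open>\<open>cf_finite \<gamma> n\<close> is $\iota\gamma_1\iota\gamma_2\cdots\iota\gamma_n$ applied to the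
  identity; the value \<open>\<gamma> 0\<close> is not used.\<close>

definition cf_finite :: "(nat \<Rightarrow> heis) \<Rightarrow> nat \<Rightarrow> heis" where
  "cf_finite \<gamma> n = foldr (\<lambda>i x. koranyi (\<gamma> i + x)) [1..<Suc n] 0"

definition cf_infinite :: "(nat \<Rightarrow> heis) \<Rightarrow> heis" where
  "cf_infinite \<gamma> = lim (cf_finite \<gamma>)"

definition dirichlet_domain :: "heis set" where
  "dirichlet_domain = {h. \<forall>g\<in>heis_int. dist 0 h \<le> dist g h}"

text \<open>The bracket $[h]$ with respect to \<open>K\<close>. Translates of the closed set \<open>dirichlet_domain\<close>
  overlap along their boundaries, so there $[h]$ is determined only up to a choice:
  a bracket function is any such choice.\<close>

definition is_bracket :: "heis set \<Rightarrow> (heis \<Rightarrow> heis) \<Rightarrow> bool" where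
  "is_bracket K br \<longleftrightarrow> (\<forall>h. br h \<in> heis_int \<and> h \<in> (\<lambda>k. br h + k) ` K)"

text \<open>\<open>cf_rem br h n\<close> is $h_n$, and \<open>CF br h n\<close> is the digit $\gamma_n$. The expansion stops as soon
  as a remainder vanishes, $\iota$ being undefined at the identity; later entries are \<open>None\<close>.\<close>

primrec cf_rem :: "(heis \<Rightarrow> heis) \<Rightarrow> heis \<Rightarrow> nat \<Rightarrow> heis option" where
  "cf_rem br h 0 = Some (- br h + h)"
| "cf_rem br h (Suc n) =
     (case cf_rem br h n of
        None \<Rightarrow> None
      | Some x \<Rightarrow> if x = 0 then None else Some (- br (koranyi x) + koranyi x))"

primrec CF :: "(heis \<Rightarrow> heis) \<Rightarrow> heis \<Rightarrow> nat \<Rightarrow> heis option" where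
  "CF br h 0 = Some (br h)"
| "CF br h (Suc n) =
     (case cf_rem br h n of
        None \<Rightarrow> None
      | Some x \<Rightarrow> if x = 0 then None else Some (br (koranyi x)))"

lemma finite_heis_int_bounded: "finite {g \<in> heis_int. gauge_norm g \<le> R}"
proof -
  let ?I = "\<lambda>R. (of_int :: int \<Rightarrow> real) ` {- \<lceil>R\<rceil>..\<lceil>R\<rceil>}"
  have I: "x \<in> ?I R" if x: "x \<in> \<int>" "\<bar>x\<bar> \<le> R" for x R
  proof -
    obtain n where "x = of_int n"
      using x(1) by (rule Ints_cases)
    with x(2) have "n \<in> {- \<lceil>R\<rceil>..\<lceil>R\<rceil>}"
      by (simp add: abs_le_iff) linarith
    then show ?thesis
      using \<open>x = of_int n\<close> by blast
  qed
  have "{g \<in> heis_int. gauge_norm g \<le> R} \<subseteq>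
      (\<lambda>(a, b, c). Heis (Complex a b) c) ` (?I R \<times> ?I R \<times> ?I (R\<^sup>2))"
  proof
    fix g assume g: "g \<in> {g \<in> heis_int. gauge_norm g \<le> R}"
    then have "cmod (hz g) \<le> R" "\<bar>ht g\<bar> \<le> R\<^sup>2"
      using gauge_norm_hz[of g] gauge_norm_ht[of g] power_mono[OF _ gauge_norm_nonneg, of g R 2]
      by auto
    then have "Re (hz g) \<in> ?I R" "Im (hz g) \<in> ?I R" "ht g \<in> ?I (R\<^sup>2)"
      using g abs_Re_le_cmod[of "hz g"] abs_Im_le_cmod[of "hz g"]
      by (auto simp: heis_int_def intro!: I)
    then show "g \<in> (\<lambda>(a, b, c). Heis (Complex a b) c) ` (?I R \<times> ?I R \<times> ?I (R\<^sup>2))"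
      by (intro image_eqI[where x = "(Re (hz g), Im (hz g), ht g)"]) auto
  qed
  then show ?thesis
    by (rule finite_subset) auto
qed

lemma heis_int_add: "g \<in> heis_int \<Longrightarrow> h \<in> heis_int \<Longrightarrow> g + h \<in> heis_int"
  by (simp add: heis_int_def plus_heis_def)

lemma dirichlet_bracket_exists: "\<exists>br. is_bracket dirichlet_domain br"
proof -
  have "\<exists>g. g \<in> heis_int \<and> h \<in> (\<lambda>k. g + k) ` dirichlet_domain" for h
  proof -
    let ?S = "{g \<in> heis_int. dist g h \<le> gauge_norm h}"
    have "gauge_norm g \<le> 2 * gauge_norm h" if "dist g h \<le> gauge_norm h" for g
      using that gauge_norm_triangle[of h "- (- g + h)"] gauge_norm_uminus[of "- g + h"]
      by (simp add: dist_heis_def minus_add)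
    then have "finite ?S"
      by (intro finite_subset[OF _ finite_heis_int_bounded[of "2 * gauge_norm h"]]) auto
    moreover have "0 \<in> ?S"
      by (simp add: heis_int_def zero_heis_def dist_heis_def gauge_norm_def plus_heis_def
          uminus_heis_def)
    ultimately have "\<exists>g\<in>?S. \<forall>g'\<in>?S. dist g h \<le> dist g' h"
      using arg_min_if_finite(1)[of ?S "\<lambda>g. dist g h"] arg_min_least[of ?S _ "\<lambda>g. dist g h"]
      by (intro bexI[of _ "arg_min_on (\<lambda>g. dist g h) ?S"]) auto
    then obtain g where g: "g \<in> ?S" "\<And>g'. g' \<in> ?S \<Longrightarrow> dist g h \<le> dist g' h"
      by blast
    have "dist 0 (- g + h) \<le> dist g' (- g + h)" if "g' \<in> heis_int" for g'
    proof -
      have "dist g h \<le> dist (g + g') h"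
        using g that heis_int_add[of g g'] by (cases "dist (g + g') h \<le> gauge_norm h") auto
      then show ?thesis
        by (simp add: dist_heis_def minus_add flip: add.assoc)
    qed
    then have "- g + h \<in> dirichlet_domain"
      by (simp add: dirichlet_domain_def)
    moreover have "h = g + (- g + h)"
      by (simp flip: add.assoc)
    ultimately show ?thesis
      using g(1) by blast
  qed
  then show ?thesis
    unfolding is_bracket_def by metis
qed

end

theory Submission
  imports Defs
begin

text \<open>The inversion \<open>koranyi\<close> satisfies \<open>dist (koranyi h) (koranyi k) = dist h k / (\<parallel>h\<parallel> \<parallel>k\<parallel>)\<close>.
  If \<open>\<parallel>x\<parallel> \<le> 1/2\<close> and \<open>\<parallel>\<gamma>\<parallel> \<ge> 3\<close>, then \<open>\<parallel>\<gamma> + x\<parallel> \<ge> 5/2\<close>; so each map \<open>x \<mapsto> koranyi (\<gamma> + x)\<close> sends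
  the ball of radius \<open>1/2\<close> into the one of radius \<open>2/5\<close> and contracts it by the factor \<open>4/25\<close>.
  Hence all tails of the continued fraction converge, to points of norm at most \<open>2/5\<close>. Nonzero integer
  points have norm at least 1, so these limits are interior to the Dirichlet domain, where the
  bracket is forced.\<close>

section \<open>The gauge metric and the inversion\<close>

text \<open>The complex number |z|^2 + it: its modulus is the squared gauge norm and it is the
  denominator in the inversion, so both reduce to complex arithmetic.\<close>

definition heis_w :: "heis \<Rightarrow> complex" where
  "heis_w h = Complex (cmod (hz h) ^ 2) (ht h)"

lemma heis_w_alt: "heis_w h = of_real (cmod (hz h) ^ 2) + \<i> * of_real (ht h)"
  by (simp add: heis_w_def complex_eq_iff)

lemma gauge_norm_power2: "gauge_norm h ^ 2 = cmod (heis_w h)"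
  by (simp add: gauge_norm_square heis_w_def)

lemma heis_w_eq_0: "heis_w h = 0 \<longleftrightarrow> h = 0"
  by (metis gauge_norm_power2 gauge_norm_eq_0 norm_eq_zero zero_eq_power2)

lemma cmod_heis_w_power2: "cmod (heis_w h) ^ 2 = cmod (hz h) ^ 4 + ht h ^ 2"
  using cmod_power2[of "heis_w h"] by (simp add: heis_w_def flip: power_mult)

text \<open>A polarization identity: the cross term of |z' - z|^2 and the twist of the group law are
  the real and imaginary parts of one complex product.\<close>

lemma heis_w_diff: "heis_w (- h + k) = cnj (heis_w h) + heis_w k - 2 * (cnj (hz h) * hz k)"
  by (simp add: heis_w_def plus_heis_def uminus_heis_def complex_eq_iff cmod_power2)
    (simp add: power2_eq_square algebra_simps)

lemma dist_0_heis: "dist 0 h = gauge_norm h" for h :: heis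
  by (simp add: dist_heis_def)

lemma dist_add_left_heis: "dist (g + h) (g + k) = dist h k" for g h k :: heis
  by (simp add: dist_heis_def minus_add flip: add.assoc)

lemma gauge_norm_le_dist: "gauge_norm g \<le> gauge_norm h + dist g h"
  using dist_triangle[of 0 g h] by (simp add: dist_0_heis dist_commute)

section \<open>The Koranyi inversion in complex form\<close>

lemma hz_koranyi: "hz (koranyi h) = - hz h / heis_w h"
  by (simp add: koranyi_def heis_w_alt)

lemma ht_koranyi: "ht (koranyi h) = - ht h / cmod (heis_w h) ^ 2"
  by (simp add: koranyi_def cmod_heis_w_power2)

lemma heis_w_koranyi: "heis_w (koranyi h) = inverse (heis_w h)"
proof -
  have "heis_w (koranyi h) = Complex (cmod (hz h) ^ 2 / cmod (heis_w h) ^ 2) (- ht h / cmod (heis_w h) ^ 2)"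
    by (simp add: heis_w_def[of "koranyi h"] hz_koranyi ht_koranyi norm_divide power_divide)
  also have "\<dots> = inverse (heis_w h)"
    by (simp add: complex_eq_iff cmod_power2[of "heis_w h"]) (simp add: heis_w_def)
  finally show ?thesis .
qed

lemma koranyi_0: "koranyi 0 = 0"
  by (simp add: koranyi_def zero_heis_def)

lemma koranyi_koranyi: "koranyi (koranyi h) = h"
proof (cases "h = 0")
  case True
  then show ?thesis by (simp add: koranyi_0)
next
  case False
  then have "heis_w h \<noteq> 0" by (simp add: heis_w_eq_0)
  then show ?thesis
    by (intro heis.expand)
      (simp add: hz_koranyi[of "koranyi h"] ht_koranyi[of "koranyi h"] heis_w_koranyi
        hz_koranyi[of h] ht_koranyi[of h] norm_inverse power_inverse)
qed

lemma gauge_norm_koranyi: "gauge_norm (koranyi h) = inverse (gauge_norm h)"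
proof -
  have "gauge_norm (koranyi h) ^ 2 = inverse (gauge_norm h) ^ 2"
    by (simp add: gauge_norm_power2 heis_w_koranyi norm_inverse power_inverse)
  then show ?thesis
    by (rule power2_eq_imp_eq) (simp_all add: gauge_norm_nonneg)
qed

lemma dist_koranyi:
  assumes "h \<noteq> 0" "k \<noteq> 0"
  shows "dist (koranyi h) (koranyi k) = dist h k / (gauge_norm h * gauge_norm k)"
proof -
  have nz: "heis_w h \<noteq> 0" "heis_w k \<noteq> 0" using assms by (simp_all add: heis_w_eq_0)
  \<comment> \<open>Over the common denominator, the numerator is again the right-hand side of
    \<open>heis_w_diff\<close>. Taking moduli gives the squared distances.\<close>
  have "heis_w (- koranyi h + koranyi k) = heis_w (- h + k) / (cnj (heis_w h) * heis_w k)"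
    using nz by (simp add: heis_w_diff heis_w_koranyi hz_koranyi field_simps)
  then have "dist (koranyi h) (koranyi k) ^ 2 = (dist h k / (gauge_norm h * gauge_norm k)) ^ 2"
    by (simp add: dist_heis_def gauge_norm_power2 power_divide power_mult_distrib
        norm_divide norm_mult)
  then show ?thesis
    by (rule power2_eq_imp_eq) (simp_all add: gauge_norm_nonneg)
qed

lemma isCont_koranyi:
  assumes "h \<noteq> 0"
  shows "isCont koranyi h"
proof -
  have lim: "((\<lambda>k. dist h k / (gauge_norm h * gauge_norm k)) \<longlongrightarrow> 0 / (gauge_norm h * gauge_norm h)) (at h)"
    using assms unfolding dist_0_heis[symmetric]
    by (intro tendsto_divide tendsto_mult tendsto_const tendsto_dist tendsto_ident_at)
      (auto intro!: tendsto_eq_intros)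
  have "\<forall>\<^sub>F k in at h. k \<noteq> 0"
    using assms by (intro tendsto_imp_eventually_ne[OF tendsto_ident_at])
  then have "\<forall>\<^sub>F k in at h. dist h k / (gauge_norm h * gauge_norm k) = dist (koranyi k) (koranyi h)"
    by eventually_elim (simp add: dist_koranyi assms dist_commute)
  with lim have "((\<lambda>k. dist (koranyi k) (koranyi h)) \<longlongrightarrow> 0) (at h)"
    using tendsto_cong by fastforce
  then show ?thesis
    unfolding isCont_def by (rule iffD2[OF tendsto_dist_iff])
qed

section \<open>Completeness of the gauge metric\<close>

lemma dist_heis_power4:
  "dist h k ^ 4 = cmod (hz k - hz h) ^ 4 + (ht k - ht h - 2 * Im (cnj (hz h) * (hz k - hz h)))\<^sup>2"
  \<comment> \<open>Since \<open>Im (cnj z * z) = 0\<close>, the twist can be written with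
    \<open>hz k - hz h\<close>, so every term visibly vanishes under coordinatewise
    convergence.\<close>
  by (simp add: dist_heis_def gauge_norm_def plus_heis_def uminus_heis_def algebra_simps)

text \<open>Both coordinates are Cauchy in the Euclidean sense, and their limits give the gauge
  limit. The twist makes the control of \<open>ht\<close> depend on the size of \<open>hz\<close>,
  hence the bound \<open>B\<close> on the first coordinates.\<close>

lemma convergent_heis_if_Cauchy:
  fixes X :: "nat \<Rightarrow> heis"
  assumes "Cauchy X"
  shows "convergent X"
proof -
  have D: "cmod (hz h - hz k) \<le> dist h k" for h k
    using gauge_norm_hz[of "- h + k"]
    by (simp add: dist_heis_def plus_heis_def uminus_heis_def norm_minus_commute)
  have "Cauchy (\<lambda>n. hz (X n))"
    using assms D unfolding Cauchy_def dist_complex_def by (meson le_less_trans)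
  then obtain z where z: "(\<lambda>n. hz (X n)) \<longlonglongrightarrow> z"
    by (auto simp: Cauchy_convergent_iff convergent_def)
  then have "Bseq (\<lambda>n. hz (X n))"
    by (meson convergentI convergent_imp_Bseq)
  then obtain B where B: "B > 0" "\<And>n. cmod (hz (X n)) \<le> B"
    by (auto elim: BseqE)
  have T: "\<bar>ht h - ht k\<bar> \<le> dist h k ^ 2 + 2 * cmod (hz h) * dist h k" for h k
  proof -
    have "\<bar>ht k - ht h - 2 * Im (cnj (hz h) * (hz k - hz h))\<bar> \<le> dist h k ^ 2"
      using gauge_norm_ht[of "- h + k"]
      by (simp add: dist_heis_def plus_heis_def uminus_heis_def algebra_simps)
    moreover have "\<bar>Im (cnj (hz h) * (hz k - hz h))\<bar> \<le> cmod (hz h) * dist h k"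
    proof -
      have "\<bar>Im (cnj (hz h) * (hz k - hz h))\<bar> \<le> cmod (hz h) * cmod (hz k - hz h)"
        by (metis abs_Im_le_cmod complex_mod_cnj norm_mult)
      also have "\<dots> \<le> cmod (hz h) * dist h k"
        by (intro mult_left_mono) (use D[of h k] in \<open>simp_all add: norm_minus_commute\<close>)
      finally show ?thesis .
    qed
    ultimately show ?thesis by linarith
  qed
  have "Cauchy (\<lambda>n. ht (X n))"
  proof (rule metric_CauchyI)
    fix e :: real assume "e > 0"
    \<comment> \<open>The cap 1 gives \<open>?D ^ 2 \<le> ?D\<close> for distances
      \<open>?D < d\<close>; the other entry makes \<open>d * (1 + 2 * B)\<close> at most
      \<open>e\<close>.\<close>
    define d where "d = min 1 (e / (1 + 2 * B))"
    have d: "d > 0" "d \<le> 1"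
      using \<open>e > 0\<close> B(1) by (auto simp: d_def)
    have "d * (1 + 2 * B) \<le> e / (1 + 2 * B) * (1 + 2 * B)"
      using B(1) by (intro mult_right_mono) (auto simp: d_def)
    then have de: "d * (1 + 2 * B) \<le> e"
      using B(1) by simp
    obtain N where N: "\<And>m n. m \<ge> N \<Longrightarrow> n \<ge> N \<Longrightarrow> dist (X m) (X n) < d"
      using assms d(1) unfolding Cauchy_def by meson
    have "dist (ht (X m)) (ht (X n)) < e" if "m \<ge> N" "n \<ge> N" for m n
    proof -
      let ?D = "dist (X m) (X n)"
      have "\<bar>ht (X m) - ht (X n)\<bar> \<le> ?D ^ 2 + 2 * cmod (hz (X m)) * ?D" by (rule T)
      also have "\<dots> \<le> ?D * 1 + 2 * B * ?D"
        unfolding power2_eq_square using N[OF that] d(2) B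
        by (intro add_mono mult_mono) auto
      also have "\<dots> = ?D * (1 + 2 * B)" by (simp add: algebra_simps)
      also have "\<dots> < d * (1 + 2 * B)" using N[OF that] B(1) by simp
      finally show ?thesis using de by (simp add: dist_real_def)
    qed
    then show "\<exists>M. \<forall>m\<ge>M. \<forall>n\<ge>M. dist (ht (X m)) (ht (X n)) < e" by blast
  qed
  then obtain t where t: "(\<lambda>n. ht (X n)) \<longlonglongrightarrow> t"
    by (auto simp: Cauchy_convergent_iff convergent_def)
  have "(\<lambda>n. dist (X n) (Heis z t) ^ 4) \<longlonglongrightarrow> 0"
    unfolding dist_heis_power4 by (auto intro!: tendsto_eq_intros z t)
  then have "(\<lambda>n. root 4 (dist (X n) (Heis z t) ^ 4)) \<longlonglongrightarrow> root 4 0"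
    by (rule tendsto_real_root)
  then have "(\<lambda>n. dist (X n) (Heis z t)) \<longlonglongrightarrow> 0"
    by (simp add: real_root_power_cancel)
  then show ?thesis
    using tendsto_dist_iff convergentI by blast
qed

section \<open>Integer points and the Dirichlet domain\<close>

lemma gauge_norm_heis_int_ge_1:
  assumes "g \<in> heis_int" "g \<noteq> 0"
  shows "gauge_norm g \<ge> 1"
proof -
  have Z: "Re (hz g) \<in> \<int>" "Im (hz g) \<in> \<int>" "ht g \<in> \<int>"
    using assms(1) by (auto simp: heis_int_def)
  have "hz g \<noteq> 0 \<or> ht g \<noteq> 0"
    using assms(2) by (cases g) (auto simp: zero_heis_def)
  then consider "Re (hz g) \<noteq> 0" | "Im (hz g) \<noteq> 0" | "ht g \<noteq> 0"
    by (auto simp: complex_eq_iff)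
  then show ?thesis
  proof cases
    case 1
    with Z have "1 \<le> \<bar>Re (hz g)\<bar>" using Ints_nonzero_abs_ge1 by blast
    then show ?thesis using abs_Re_le_cmod[of "hz g"] gauge_norm_hz[of g] by linarith
  next
    case 2
    with Z have "1 \<le> \<bar>Im (hz g)\<bar>" using Ints_nonzero_abs_ge1 by blast
    then show ?thesis using abs_Im_le_cmod[of "hz g"] gauge_norm_hz[of g] by linarith
  next
    case 3
    with Z have "1 \<le> \<bar>ht g\<bar>" using Ints_nonzero_abs_ge1 by blast
    then have "1\<^sup>2 \<le> gauge_norm g ^ 2" using gauge_norm_ht[of g] by simp
    then show ?thesis using gauge_norm_nonneg power2_le_imp_le by blast
  qed
qed

lemma heis_int_0: "0 \<in> heis_int"
  by (simp add: heis_int_def zero_heis_def)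

lemma heis_int_uminus: "g \<in> heis_int \<Longrightarrow> - g \<in> heis_int"
  by (simp add: heis_int_def uminus_heis_def)

text \<open>Another digit \<open>b\<close> would differ from \<open>g\<close> by a nonzero integer
  point \<open>u\<close>, and the remainder \<open>k = u + x\<close> has distance
  \<open>gauge_norm x\<close> from \<open>u\<close>. Being in the Dirichlet domain, \<open>k\<close>
  is no farther from 0, so \<open>1 \<le> gauge_norm u \<le> 2 * gauge_norm x < 1\<close>.\<close>

lemma is_bracket_eqI:
  assumes br: "is_bracket dirichlet_domain br"
    and g: "g \<in> heis_int" and x: "gauge_norm x < 1 / 2"
  shows "br (g + x) = g"
proof (rule ccontr)
  assume ne: "br (g + x) \<noteq> g"
  define b where "b = br (g + x)"
  have b: "b \<in> heis_int" using br by (simp add: is_bracket_def b_def)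
  obtain k where k: "k \<in> dirichlet_domain" "g + x = b + k"
    using br unfolding is_bracket_def b_def by blast
  define u where "u = - b + g"
  have u: "u \<in> heis_int" "u \<noteq> 0"
    using heis_int_add[OF heis_int_uminus[OF b] g] ne
    unfolding u_def b_def by (simp, metis add_eq_0_iff2 neg_equal_iff_equal)
  have ku: "k = u + x"
    by (metis u_def k(2) add.assoc minus_add_cancel)
  have "gauge_norm k \<le> dist u k"
    using k(1) u(1) by (simp add: dirichlet_domain_def dist_0_heis)
  also have "\<dots> = gauge_norm x" by (simp add: ku dist_heis_def add.assoc)
  finally have "gauge_norm k \<le> gauge_norm x" .
  moreover have "gauge_norm u \<le> gauge_norm k + dist u k"
    by (rule gauge_norm_le_dist)
  ultimately show False
    using gauge_norm_heis_int_ge_1[OF u] x \<open>dist u k = gauge_norm x\<close> by linarith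
qed

section \<open>Convergence and uniqueness of the digits\<close>

lemma gauge_norm_add_ge:
  assumes "gauge_norm g \<ge> 3" "gauge_norm x \<le> 1 / 2"
  shows "gauge_norm (g + x) \<ge> 5 / 2"
  using gauge_norm_le_dist[of g "g + x"] assms by (simp add: dist_heis_def add.assoc)

lemma gauge_norm_koranyi_add_le:
  assumes "gauge_norm g \<ge> 3" "gauge_norm x \<le> 1 / 2"
  shows "gauge_norm (koranyi (g + x)) \<le> 2 / 5"
  using le_imp_inverse_le[OF gauge_norm_add_ge[OF assms]] by (simp add: gauge_norm_koranyi)

lemma add_nonzero:
  assumes "gauge_norm g \<ge> 3" "gauge_norm x \<le> 1 / 2"
  shows "g + x \<noteq> 0"
  using gauge_norm_add_ge[OF assms] gauge_norm_eq_0[of "g + x"] by auto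

text \<open>Left translation is an isometry, and the inversion divides the distance by two norms,
  each at least 5/2.\<close>

lemma dist_koranyi_add_le:
  assumes "gauge_norm g \<ge> 3" "gauge_norm x \<le> 1 / 2" "gauge_norm y \<le> 1 / 2"
  shows "dist (koranyi (g + x)) (koranyi (g + y)) \<le> 4 / 25 * dist x y"
proof -
  have "5 / 2 * (5 / 2) \<le> gauge_norm (g + x) * gauge_norm (g + y)"
    using assms by (intro mult_mono gauge_norm_add_ge) (auto simp: gauge_norm_nonneg)
  then have "dist x y / (gauge_norm (g + x) * gauge_norm (g + y)) \<le> dist x y / (5 / 2 * (5 / 2))"
    by (intro divide_left_mono) auto
  then show ?thesis
    using assms by (simp add: dist_koranyi add_nonzero dist_add_left_heis)
qed

section \<open>Finite continued fractions\<close>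

lemma cf_finite_0: "cf_finite \<gamma> 0 = 0"
  by (simp add: cf_finite_def)

text \<open>Peeling off the outermost map shifts the digits, so the inductions below keep
  \<open>\<gamma>\<close> arbitrary.\<close>

lemma cf_finite_Suc: "cf_finite \<gamma> (Suc n) = koranyi (\<gamma> 1 + cf_finite (\<lambda>i. \<gamma> (Suc i)) n)"
proof -
  have "[1..<Suc (Suc n)] = 1 # map Suc [1..<Suc n]"
    by (simp only: map_Suc_upt) (simp add: upt_conv_Cons)
  then show ?thesis
    unfolding cf_finite_def by (simp add: foldr_map o_def del: upt_Suc)
qed

lemma gauge_norm_cf_finite_le:
  assumes "\<And>i. i \<ge> 1 \<Longrightarrow> gauge_norm (\<gamma> i) \<ge> 3"
  shows "gauge_norm (cf_finite \<gamma> n) \<le> 2 / 5"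
  using assms
proof (induction n arbitrary: \<gamma>)
  case 0
  then show ?case using gauge_norm_eq_0[of 0] by (simp add: cf_finite_0)
next
  case (Suc n)
  have "gauge_norm (cf_finite (\<lambda>i. \<gamma> (Suc i)) n) \<le> 2 / 5"
    by (intro Suc.IH Suc.prems) auto
  then show ?case
    unfolding cf_finite_Suc by (intro gauge_norm_koranyi_add_le Suc.prems) auto
qed

text \<open>Both fractions share their \<open>n\<close> outermost maps, each of which contracts by
  4/25; the points these maps act on are at distance at most 2/5, hence at most 1.\<close>

lemma dist_cf_finite_le:
  assumes "\<And>i. i \<ge> 1 \<Longrightarrow> gauge_norm (\<gamma> i) \<ge> 3"
  shows "dist (cf_finite \<gamma> n) (cf_finite \<gamma> (n + k)) \<le> (4 / 25) ^ n"
  using assms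
proof (induction n arbitrary: \<gamma>)
  case 0
  then show ?case
    using gauge_norm_cf_finite_le[of \<gamma> k] by (simp add: cf_finite_0 dist_0_heis)
next
  case (Suc n)
  let ?\<delta> = "\<lambda>i. \<gamma> (Suc i)"
  have \<delta>: "gauge_norm (?\<delta> i) \<ge> 3" if "i \<ge> 1" for i using Suc.prems by simp
  have half: "gauge_norm (cf_finite ?\<delta> m) \<le> 1 / 2" for m
    using gauge_norm_cf_finite_le[of ?\<delta> m, OF \<delta>] by simp
  have "dist (cf_finite \<gamma> (Suc n)) (cf_finite \<gamma> (Suc n + k))
      \<le> 4 / 25 * dist (cf_finite ?\<delta> n) (cf_finite ?\<delta> (n + k))"
    unfolding add_Suc cf_finite_Suc by (intro dist_koranyi_add_le Suc.prems half) simp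
  also have "\<dots> \<le> 4 / 25 * (4 / 25) ^ n"
    by (intro mult_left_mono Suc.IH \<delta>) auto
  finally show ?case by simp
qed

lemma convergent_cf_finite:
  assumes "\<And>i. i \<ge> 1 \<Longrightarrow> gauge_norm (\<gamma> i) \<ge> 3"
  shows "convergent (cf_finite \<gamma>)"
proof (rule convergent_heis_if_Cauchy, rule CauchyI')
  fix e :: real assume "e > 0"
  then obtain N where N: "(4 / 25) ^ N < e"
    using real_arch_pow_inv[of e "4 / 25"] by auto
  have "dist (cf_finite \<gamma> m) (cf_finite \<gamma> n) < e" if "m \<ge> N" "n > m" for m n
  proof -
    have "dist (cf_finite \<gamma> m) (cf_finite \<gamma> n) \<le> (4 / 25) ^ m"
      using dist_cf_finite_le[of \<gamma> m "n - m", OF assms] that by simp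
    also have "\<dots> \<le> (4 / 25) ^ N" using that by (intro power_decreasing) auto
    finally show ?thesis using N by simp
  qed
  then show "\<exists>M. \<forall>m\<ge>M. \<forall>n>m. dist (cf_finite \<gamma> m) (cf_finite \<gamma> n) < e" by blast
qed

section \<open>Limits of continued fractions\<close>

lemma cf_finite_tendsto:
  assumes "\<And>i. i \<ge> 1 \<Longrightarrow> gauge_norm (\<gamma> i) \<ge> 3"
  shows "cf_finite \<gamma> \<longlonglongrightarrow> cf_infinite \<gamma>"
  using convergent_cf_finite[OF assms] by (simp add: cf_infinite_def convergent_LIMSEQ_iff)

lemma gauge_norm_cf_infinite_le:
  assumes "\<And>i. i \<ge> 1 \<Longrightarrow> gauge_norm (\<gamma> i) \<ge> 3"
  shows "gauge_norm (cf_infinite \<gamma>) \<le> 2 / 5"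
proof (rule tendsto_upperbound)
  show "(\<lambda>n. gauge_norm (cf_finite \<gamma> n)) \<longlonglongrightarrow> gauge_norm (cf_infinite \<gamma>)"
    unfolding dist_0_heis[symmetric]
    by (intro tendsto_dist tendsto_const cf_finite_tendsto assms)
  show "\<forall>\<^sub>F n in sequentially. gauge_norm (cf_finite \<gamma> n) \<le> 2 / 5"
    by (intro always_eventually allI gauge_norm_cf_finite_le assms)
qed simp

text \<open>The limit of \<open>cf_finite_Suc\<close>: left translation preserves distances, and the
  inversion is continuous at the translated limit, which is nonzero.\<close>

lemma cf_infinite_rec:
  assumes "\<And>i. i \<ge> 1 \<Longrightarrow> gauge_norm (\<gamma> i) \<ge> 3"
  shows "cf_infinite \<gamma> = koranyi (\<gamma> 1 + cf_infinite (\<lambda>i. \<gamma> (Suc i)))"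
proof -
  let ?\<delta> = "\<lambda>i. \<gamma> (Suc i)"
  have \<delta>: "gauge_norm (?\<delta> i) \<ge> 3" if "i \<ge> 1" for i using assms by simp
  have "(\<lambda>n. dist (\<gamma> 1 + cf_finite ?\<delta> n) (\<gamma> 1 + cf_infinite ?\<delta>)) \<longlonglongrightarrow> 0"
    unfolding dist_add_left_heis using cf_finite_tendsto[of ?\<delta>, OF \<delta>] tendsto_dist_iff by blast
  then have "(\<lambda>n. \<gamma> 1 + cf_finite ?\<delta> n) \<longlonglongrightarrow> \<gamma> 1 + cf_infinite ?\<delta>"
    by (rule iffD2[OF tendsto_dist_iff])
  moreover have "\<gamma> 1 + cf_infinite ?\<delta> \<noteq> 0"
    using gauge_norm_cf_infinite_le[of ?\<delta>, OF \<delta>] by (intro add_nonzero assms) auto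
  ultimately have "(\<lambda>n. koranyi (\<gamma> 1 + cf_finite ?\<delta> n)) \<longlonglongrightarrow> koranyi (\<gamma> 1 + cf_infinite ?\<delta>)"
    using isCont_tendsto_compose isCont_koranyi by blast
  then have "(\<lambda>n. cf_finite \<gamma> (Suc n)) \<longlonglongrightarrow> koranyi (\<gamma> 1 + cf_infinite ?\<delta>)"
    by (simp add: cf_finite_Suc)
  moreover have "(\<lambda>n. cf_finite \<gamma> (Suc n)) \<longlonglongrightarrow> cf_infinite \<gamma>"
    by (intro LIMSEQ_Suc cf_finite_tendsto assms)
  ultimately show ?thesis
    using LIMSEQ_unique by blast
qed

theorem theorem3p7:
  fixes \<gamma> :: "nat \<Rightarrow> heis"
  assumes "\<And>i. i \<ge> 1 \<Longrightarrow> \<gamma> i \<in> heis_int"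
    and "\<And>i. i \<ge> 1 \<Longrightarrow> gauge_norm (\<gamma> i) \<ge> 3"
  shows "convergent (cf_finite \<gamma>) \<and>
    (\<forall>br. is_bracket dirichlet_domain br \<longrightarrow>
       CF br (cf_infinite \<gamma>) 0 = Some 0 \<and>
       (\<forall>i\<ge>1. CF br (cf_infinite \<gamma>) i = Some (\<gamma> i)))"
proof (intro conjI allI impI)
  show "convergent (cf_finite \<gamma>)" by (rule convergent_cf_finite[OF assms(2)])
next
  fix br assume br: "is_bracket dirichlet_domain br"
  \<comment> \<open>The limit of the tail whose first digit is \<open>\<gamma> (Suc n)\<close>, as
    \<open>cf_finite\<close> starts at index 1. It will turn out to be the remainder after
    \<open>n\<close> steps.\<close>
  define L where "L n = cf_infinite (\<lambda>i. \<gamma> (i + n))" for n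
  have small: "gauge_norm (L n) \<le> 2 / 5" for n
    unfolding L_def by (intro gauge_norm_cf_infinite_le assms) auto
  have L: "L n = koranyi (\<gamma> (Suc n) + L (Suc n))" for n
    using cf_infinite_rec[of "\<lambda>i. \<gamma> (i + n)"] assms(2) by (simp add: L_def)
  then have koranyi_L: "koranyi (L n) = \<gamma> (Suc n) + L (Suc n)" for n
    by (metis koranyi_koranyi)
  \<comment> \<open>This keeps the expansion from stopping. By the default value
    \<open>koranyi 0 = 0\<close>, a nonzero image suffices.\<close>
  have L_nonzero: "L n \<noteq> 0" for n
  proof -
    have "koranyi (L n) \<noteq> 0"
      unfolding koranyi_L[of n] using small[of "Suc n"] by (intro add_nonzero assms) auto
    then show ?thesis by (auto simp: koranyi_0)
  qed
  \<comment> \<open>Apply the forced bracket to \<open>0 + L 0\<close>, with integer point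
    0.\<close>
  have br_0: "br (L 0) = 0"
    using is_bracket_eqI[OF br, of 0 "L 0"] small[of 0] heis_int_0 by simp
  have br_koranyi_L: "br (koranyi (L n)) = \<gamma> (Suc n)" for n
    unfolding koranyi_L using small[of "Suc n"] by (intro is_bracket_eqI[OF br] assms) auto
  \<comment> \<open>Removing the digit \<open>\<gamma> (Suc n)\<close> on the left of
    \<open>koranyi (L n)\<close> leaves \<open>L (Suc n)\<close>.\<close>
  have rem: "cf_rem br (L 0) n = Some (L n)" for n
    by (induction n) (simp_all add: br_0 br_koranyi_L L_nonzero, simp add: koranyi_L flip: add.assoc)
  have L0: "cf_infinite \<gamma> = L 0" by (simp add: L_def)
  show "CF br (cf_infinite \<gamma>) 0 = Some 0"
    by (simp add: L0 br_0)
  fix i :: nat assume "i \<ge> 1"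
  then obtain n where "i = Suc n" by (cases i) auto
  then show "CF br (cf_infinite \<gamma>) i = Some (\<gamma> i)"
    by (simp add: L0 rem L_nonzero br_koranyi_L)
qed

end
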